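(* For every natural number $n\geq 2$, \[ \varphi^3(n)\big(\psi(n)+\sigma(n)\big)+\psi^3(n)\big(\varphi(n)+\sigma(n)\big)+\sigma^3(n)\big(\varphi(n)+\psi(n)\big)\geq 6n^4+8n^3+12n^2+8n-2. \]
   Context: For a natural number $n$, $\varphi(n)$ is Euler's totient function (the number of positive integers not exceeding $n$ that are coprime to $n$). For $n=p_1^{a_1}\cdots p_k^{a_k}$ (distinct primes $p_i$, $a_i\geq1$), the Dedekind function is $\psi(n)=\prod_{i=1}^k p_i^{a_i-1}(p_i+1)$, with $\psi(1)=1$. $\sigma(n)$ denotes the sum of the positive divisors of $n$. *)

theory Defs
  imports "HOL-Number_Theory.Number_Theory"
begin

definition dedekind_psi :: "nat \<Rightarrow> nat" where
  "dedekind_psi n = (\<Prod>p\<in>prime_factors n. p ^ (multiplicity p n - 1) * (p + 1))"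

(* Intended for n > 0: every natural number divides 0, and the sum over this
   infinite set is 0 by convention. *)
definition divisor_sigma :: "nat \<Rightarrow> nat" where
  "divisor_sigma n = (\<Sum>d | d dvd n. d)"

end

theory Submission
  imports Defs
begin

text \<open>
  Adjoining one prime factor at a time shows \<open>\<psi>(n) \<le> \<sigma>(n)\<close> and \<open>\<phi>(n) + \<psi>(n) \<ge> 2n\<close>.
  The left-hand side is increasing in \<open>\<sigma>\<close> and \<open>\<psi>\<close>, so with \<open>\<phi>(n) = n - t\<close>, \<open>t \<ge> 1\<close>,
  it is at least its value at \<open>\<psi> = \<sigma> = n + t\<close>. That value, \<open>2(n+t)(3n^3 + n^2 t + 5 n t^2 - t^3)\<close>,
  is increasing in \<open>t \<le> n\<close> and at \<open>t = 1\<close> equals the claimed bound; this is the case of prime \<open>n\<close>.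
\<close>

text \<open>Multiplying by \<open>p\<close> leaves the factors at all other primes (the set
  \<open>A\<close>) unchanged. At \<open>p\<close> the exponent grows by one if \<open>p\<close>
  already divides \<open>n\<close>; otherwise a new factor \<open>p + 1\<close> appears.\<close>

lemma dedekind_psi_prime_mult:
  assumes p: "prime p" and n: "n > 0"
  shows "dedekind_psi (p * n) = (if p dvd n then p else p + 1) * dedekind_psi n"
proof -
  define f where "f = (\<lambda>m q::nat. q ^ (multiplicity q m - 1) * (q + 1))"
  have psi: "dedekind_psi m = prod (f m) (prime_factors m)" for m
    by (simp only: dedekind_psi_def f_def)
  define A where "A = prime_factors n - {p}"
  have [simp]: "finite A" "p \<notin> A" by (auto simp: A_def)
  have pf: "prime_factors (p * n) = insert p A"
    using p n by (auto simp: A_def prime_factors_product prime_factorization_prime)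
  have "f (p * n) q = f n q" if "q \<in> A" for q
  proof -
    have "prime q" "q \<noteq> p" using that by (auto simp: A_def)
    hence "multiplicity q (p * n) = multiplicity q n"
      using p n by (simp add: prime_elem_multiplicity_mult_distrib prime_multiplicity_other)
    thus ?thesis by (simp add: f_def)
  qed
  hence A: "prod (f (p * n)) A = prod (f n) A" by simp
  have "multiplicity p (p * n) = Suc (multiplicity p n)"
    using p n by (intro multiplicity_times_same) (auto dest: prime_gt_1_nat)
  hence fp: "f (p * n) p = p ^ multiplicity p n * (p + 1)" by (simp add: f_def)
  have lhs: "dedekind_psi (p * n) = f (p * n) p * prod (f n) A"
    using A by (simp add: psi pf)
  show ?thesis
  proof (cases "p dvd n")
    case True
    hence "prime_factors n = insert p A"
      using p n by (auto simp: A_def in_prime_factors_iff)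
    hence rhs: "dedekind_psi n = f n p * prod (f n) A"
      by (simp add: psi)
    \<comment> \<open>Positivity is needed because the exponent \<open>multiplicity p n - 1\<close>
      is a truncated subtraction.\<close>
    have "multiplicity p n > 0"
      using p n True by (simp add: prime_multiplicity_gt_zero_iff)
    hence "p ^ multiplicity p n = p * p ^ (multiplicity p n - 1)"
      by (cases "multiplicity p n") auto
    hence "f (p * n) p = p * f n p" by (simp only: fp) (simp only: f_def mult.assoc)
    with True lhs rhs show ?thesis by simp
  next
    case False
    hence "prime_factors n = A" by (auto simp: A_def)
    hence "dedekind_psi n = prod (f n) A" by (simp add: psi)
    with False lhs fp show ?thesis by (simp add: not_dvd_imp_multiplicity_0)
  qed
qed

lemma totient_prime_mult:
  assumes "prime p"
  shows "totient (p * n) = (if p dvd n then p else p - 1) * totient n"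
proof (cases "p dvd n")
  case True
  with assms show ?thesis by (simp add: totient_mult gcd_nat.absorb1 prime_gt_0_nat)
next
  case False
  with assms have "coprime p n" by (simp add: prime_imp_coprime)
  with assms False show ?thesis by (simp add: totient_mult_coprime totient_prime)
qed

text \<open>The numbers \<open>p * d\<close> with \<open>d\<close> dividing \<open>n\<close> are
  divisors of \<open>p * n\<close>. If \<open>p\<close> does not divide \<open>n\<close>, the
  divisors of \<open>n\<close> itself are further ones, disjoint from these.\<close>

lemma divisor_sigma_prime_mult_ge:
  assumes p: "prime p" and n: "n > 0"
  shows "divisor_sigma (p * n) \<ge> (if p dvd n then p else p + 1) * divisor_sigma n"
proof -
  define D where "D = {d. d dvd n}"
  have fin: "finite D" "finite {d. d dvd p * n}"
    using p n by (auto simp: D_def prime_gt_0_nat intro!: finite_divisors_nat)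
  have image: "\<Sum>((*) p ` D) = p * \<Sum>D"
    using p by (subst sum.reindex) (auto simp: inj_on_def sum_distrib_left)
  show ?thesis
  proof (cases "p dvd n")
    case True
    have "\<Sum>((*) p ` D) \<le> \<Sum>{d. d dvd p * n}"
      using fin by (intro sum_mono2) (auto simp: D_def)
    with True image show ?thesis by (simp add: divisor_sigma_def D_def)
  next
    case False
    hence "(*) p ` D \<inter> D = {}" by (auto simp: D_def dest: dvd_mult_left)
    hence "\<Sum>((*) p ` D \<union> D) = (p + 1) * \<Sum>D"
      using fin image by (subst sum.union_disjoint) auto
    moreover have "\<Sum>((*) p ` D \<union> D) \<le> \<Sum>{d. d dvd p * n}"
      using fin by (intro sum_mono2) (auto simp: D_def)
    ultimately show ?thesis using False by (simp add: divisor_sigma_def D_def)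
  qed
qed

text \<open>Both sides are 1 at 1, and the recursion that \<open>dedekind_psi\<close> satisfies with
  equality holds for \<open>divisor_sigma\<close> as a lower bound.\<close>

lemma dedekind_psi_le_divisor_sigma:
  assumes "n > 0"
  shows "dedekind_psi n \<le> divisor_sigma n"
  using assms
proof (induction n rule: prime_divisors_induct)
  case (unit n)
  then show ?case by (simp add: dedekind_psi_def divisor_sigma_def)
next
  case (factor p n)
  hence "n > 0" by simp
  hence "dedekind_psi (p * n) \<le> (if p dvd n then p else p + 1) * divisor_sigma n"
    using factor by (simp only: dedekind_psi_prime_mult) (intro mult_left_mono, auto)
  also have "\<dots> \<le> divisor_sigma (p * n)"
    using factor.hyps \<open>n > 0\<close> by (rule divisor_sigma_prime_mult_ge)
  finally show ?case .
qed simp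

lemma dedekind_psi_ge:
  assumes "n > 0"
  shows "n \<le> dedekind_psi n"
  using assms
proof (induction n rule: prime_divisors_induct)
  case (factor p n)
  then show ?case by (auto simp: dedekind_psi_prime_mult intro: trans_le_add2)
qed (simp_all add: dedekind_psi_def)

text \<open>Adjoining \<open>p\<close> multiplies the sum by exactly \<open>p\<close> if
  \<open>p\<close> divides \<open>n\<close>. Otherwise the new sum exceeds \<open>p\<close> times
  the old one by \<open>dedekind_psi n - totient n\<close>, which is nonnegative since
  \<open>n\<close> lies between the two.\<close>

lemma totient_plus_dedekind_psi_ge:
  assumes "n > 0"
  shows "2 * n \<le> totient n + dedekind_psi n"
  using assms
proof (induction n rule: prime_divisors_induct)
  case (unit n)
  then show ?case by (simp add: dedekind_psi_def)
next
  case (factor p n)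
  hence n: "n > 0" by simp
  have p: "p \<ge> 1" using factor.hyps by (rule prime_ge_1_nat)
  have "p * (2 * n) \<le> p * (totient n + dedekind_psi n)"
    using factor n by (intro mult_left_mono) auto
  also have "\<dots> \<le> totient (p * n) + dedekind_psi (p * n)"
  proof (cases "p dvd n")
    case True
    with factor.hyps n show ?thesis
      by (simp add: totient_prime_mult dedekind_psi_prime_mult distrib_left)
  next
    case False
    have "totient n \<le> dedekind_psi n"
      using totient_le[of n] dedekind_psi_ge[OF n] by linarith
    moreover have "p * totient n = (p - 1) * totient n + totient n"
      using p by (cases p) auto
    ultimately show ?thesis using False factor.hyps n
      by (simp add: totient_prime_mult dedekind_psi_prime_mult distrib_left)
  qed
  finally show ?case by (simp add: mult_ac)
qed simp

theorem theorem5: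
  fixes n :: nat
  assumes "n \<ge> 2"
  shows "int (totient n) ^ 3 * (int (dedekind_psi n) + int (divisor_sigma n))
       + int (dedekind_psi n) ^ 3 * (int (totient n) + int (divisor_sigma n))
       + int (divisor_sigma n) ^ 3 * (int (totient n) + int (dedekind_psi n))
       \<ge> 6 * int n ^ 4 + 8 * int n ^ 3 + 12 * int n ^ 2 + 8 * int n - 2"
proof -
  define a b c N where "a = int (totient n)" and "b = int (dedekind_psi n)"
    and "c = int (divisor_sigma n)" and "N = int n"
  define t where "t = N - a"
  have "totient n < n" using assms by (intro totient_less) simp
  hence t: "1 \<le> t" "t \<le> N" by (auto simp: t_def a_def N_def)
  have a: "a = N - t" "0 \<le> a" by (auto simp: t_def a_def)
  have "2 * N \<le> a + b"
    using totient_plus_dedekind_psi_ge[of n] assms unfolding a_def b_def N_def by linarith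
  hence b: "N + t \<le> b" by (simp add: a)
  have c: "b \<le> c"
    using dedekind_psi_le_divisor_sigma[of n] assms unfolding b_def c_def by linarith
  have [simp]: "0 \<le> N + t" "0 \<le> b" "0 \<le> c" using t b c by linarith+
  have "6 * N ^ 4 + 8 * N ^ 3 + 12 * N ^ 2 + 8 * N - 2
        = 2 * ((N + 1) * (3 * N ^ 3 + N ^ 2 + 5 * N - 1))"
    by (simp add: algebra_simps power_numeral_reduce)
  also have "\<dots> \<le> 2 * ((N + t) * (3 * N ^ 3 + N ^ 2 * t + 5 * N * t ^ 2 - t ^ 3))"
  proof (intro mult_left_mono mult_mono)
    have "t * t \<le> N * t" "t \<le> N * t" "1 \<le> N * t" "1 \<le> N"
      using t mult_mono[of 1 N 1 t] by (auto simp: mult_right_mono)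
    moreover have "0 \<le> N ^ 2" by simp
    \<comment> \<open>This is the cofactor of \<open>t - 1\<close> in the difference of the cubic
      factors at \<open>t\<close> and at 1. Each of \<open>t * t\<close>, \<open>t\<close> and 1 is
      at most \<open>N * t\<close>, so \<open>5 * (N * t)\<close> absorbs all three.\<close>
    ultimately have "0 \<le> N ^ 2 + 5 * N + 5 * (N * t) - (t * t + t + 1)" using t by linarith
    hence "0 \<le> (t - 1) * (N ^ 2 + 5 * N + 5 * (N * t) - (t * t + t + 1))"
      using t by (intro mult_nonneg_nonneg) auto
    thus "3 * N ^ 3 + N ^ 2 + 5 * N - 1 \<le> 3 * N ^ 3 + N ^ 2 * t + 5 * N * t ^ 2 - t ^ 3"
      by (simp add: algebra_simps power_numeral_reduce)
    have "0 \<le> N ^ 3" "0 \<le> N ^ 2" "1 \<le> N" using t by auto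
    thus "0 \<le> 3 * N ^ 3 + N ^ 2 + 5 * N - 1" by linarith
  qed (use t in auto)
  \<comment> \<open>With \<open>a = N - t\<close>, this is the left-hand side of the theorem at
    \<open>b = c = N + t\<close>.\<close>
  also have "\<dots> = 2 * (a ^ 3 * (N + t) + (N + t) ^ 3 * (a + (N + t)))"
    unfolding a(1) by (simp add: algebra_simps power_numeral_reduce)
  also have "\<dots> \<le> 2 * (a ^ 3 * b + b ^ 3 * (a + b))"
    using a b t by (intro mult_left_mono add_mono mult_mono power_mono) auto
  \<comment> \<open>Splitting the doubled terms gives the left-hand side at \<open>c = b\<close>, so
    that replacing \<open>b\<close> by \<open>c\<close> can proceed summand by summand.\<close>
  also have "\<dots> = a ^ 3 * (b + b) + b ^ 3 * (a + b) + b ^ 3 * (a + b)"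
    by (simp add: algebra_simps)
  also have "\<dots> \<le> a ^ 3 * (b + c) + b ^ 3 * (a + c) + c ^ 3 * (a + b)"
    using a b c t by (intro add_mono mult_mono power_mono) auto
  finally show ?thesis by (simp add: a_def b_def c_def N_def)
qed

end
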